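(* Let $f \in \mathbb{K}[z]$ be a polynomial of degree $n \ge 2$. Suppose there exists a vector $x \in \mathbb{K}^n$ with distinct components such that $$\left\| \frac{W_f(x)}{d(x)} \right\|_p \le \frac{R(1+(b-1)R)}{(1+bR)(1+(a+b-1)R)}$$ for some $1 \le p \le \infty$ and $0 < R \le 1/(1-b+\sqrt{a})$, where $a = (n-1)^{1/q}$, $b = 2^{1/q}$ and $q$ is the conjugate exponent of $p$ (when $1-b+\sqrt{a} = 0$, which happens exactly for $n=2$ and $p=\infty$, the bound $1/(1-b+\sqrt{a})$ is read as $+\infty$, i.e. any $R > 0$ is allowed). Then $f$ has only simple zeros in $\mathbb{K}$ and there exists a root-vector $\xi \in \mathbb{K}^n$ of $f$ such that $$\left\| \frac{x-\xi}{d(\xi)} \right\|_p \le R.$$ If the first displayed inequality is strict, then the last inequality is strict too.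
   Context: $(\mathbb{K},|\cdot|)$ is an algebraically closed normed field (a field with an absolute value) and $\mathbb{K}[z]$ is the ring of polynomials over $\mathbb{K}$. For $1 \le p \le \infty$, the $p$-norm on $\mathbb{K}^n$ and on $\mathbb{R}^n$ is $\|x\|_p = \left(\sum_{i=1}^n |x_i|^p\right)^{1/p}$ ($\|x\|_\infty = \max_i |x_i|$). The conjugate exponent $q$ of $p$ is defined by $1 \le q \le \infty$ and $1/p+1/q=1$ (with $1/\infty = 0$). For $x \in \mathbb{K}^n$, $d(x) = (d_1(x),\ldots,d_n(x)) \in \mathbb{R}^n$ with $d_i(x) = \min_{j\ne i}|x_i-x_j|$. For $x \in \mathbb{K}^n$ and $y \in \mathbb{R}^n$ with no zero components, $\frac{x}{y} = \left(\frac{|x_1|}{y_1},\ldots,\frac{|x_n|}{y_n}\right) \in \mathbb{R}^n$. For a polynomial $f \in \mathbb{K}[z]$ of degree $n \ge 2$ with leading coefficient $a_0$ and a vector $x \in \mathbb{K}^n$ with distinct components, the Weierstrass correction is $W_f(x) = (W_1(x),\ldots,W_n(x))$ with $W_i(x) = \frac{f(x_i)}{a_0\prod_{j\ne i}(x_i-x_j)}$. A vector $\xi \in \mathbb{K}^n$ is a root-vector of $f$ if $f(z) = a_0\prod_{i=1}^n (z-\xi_i)$ for all $z \in \mathbb{K}$. *)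

theory Defs
  imports
    "HOL-Analysis.Analysis"
    "HOL-Computational_Algebra.Computational_Algebra"
begin

text \<open>
  The absolute value is an arbitrary multiplicative one, possibly non-Archimedean or trivial, and
  the field may have any characteristic; the classes of normed fields in the library are
  \<open>\<real>\<close>-algebras, so they are not used.
\<close>

locale absolute_value =
  fixes av :: "'a::field \<Rightarrow> real"
  assumes av_nonneg: "0 \<le> av x"
    and av_eq_0_iff: "av x = 0 \<longleftrightarrow> x = 0"
    and av_mult: "av (x * y) = av x * av y"
    and av_triangle: "av (x + y) \<le> av x + av y"

definition p_norm :: "ennreal \<Rightarrow> real ^ 'n \<Rightarrow> real" where
  "p_norm p u =
     (if p = \<infinity> then Max (range (\<lambda>i. \<bar>u $ i\<bar>))
      else (\<Sum>i\<in>UNIV. \<bar>u $ i\<bar> powr enn2real p) powr (1 / enn2real p))"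

text \<open>In \<^typ>\<open>ennreal\<close> we have \<open>1 / \<infinity> = 0\<close>, as the definition of the conjugate exponent requires.\<close>

definition conjugate_exponent :: "ennreal \<Rightarrow> ennreal \<Rightarrow> bool" where
  "conjugate_exponent p q \<longleftrightarrow> 1 \<le> q \<and> 1 / p + 1 / q = 1"

text \<open>The minimum is over a nonempty set only if there are at least two indices.\<close>

definition min_dist :: "('a::field \<Rightarrow> real) \<Rightarrow> 'a ^ 'n \<Rightarrow> real ^ 'n" where
  "min_dist av x = (\<chi> i. Min ((\<lambda>j. av (x $ i - x $ j)) ` (UNIV - {i})))"

definition av_quotient :: "('a::field \<Rightarrow> real) \<Rightarrow> 'a ^ 'n \<Rightarrow> real ^ 'n \<Rightarrow> real ^ 'n" where
  "av_quotient av x y = (\<chi> i. av (x $ i) / y $ i)"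

definition weierstrass_correction :: "'a::field poly \<Rightarrow> 'a ^ 'n \<Rightarrow> 'a ^ 'n" where
  "weierstrass_correction f x =
     (\<chi> i. poly f (x $ i) / (lead_coeff f * (\<Prod>j\<in>UNIV - {i}. x $ i - x $ j)))"

definition root_vector :: "'a::field poly \<Rightarrow> 'a ^ 'n \<Rightarrow> bool" where
  "root_vector f \<xi> \<longleftrightarrow> (\<forall>z. poly f z = lead_coeff f * (\<Prod>i\<in>UNIV. z - \<xi> $ i))"

definition only_simple_zeros :: "'a::field poly \<Rightarrow> bool" where
  "only_simple_zeros f \<longleftrightarrow> (\<forall>z. poly f z = 0 \<longrightarrow> order z f = 1)"

end

theory Submission
  imports Defs
begin

text \<open>
  Write \<open>W\<close> for the Weierstrass correction, \<open>d\<close> for the minimal distances of \<open>x\<close>, and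
  \<open>w = W / d\<close>. Lagrange interpolation at the components of \<open>x\<close> gives
  \<open>f(z) = a\<^sub>0 (\<Prod>\<^sub>j (z - x\<^sub>j) + \<Sum>\<^sub>k W\<^sub>k \<Prod>\<^sub>j\<^sub>\<noteq>\<^sub>k (z - x\<^sub>j))\<close>, so near \<open>x\<^sub>i\<close> the roots of \<open>f\<close> are the fixed points of
  \<open>g\<^sub>i(z) = x\<^sub>i - W\<^sub>i / (1 + \<Sum>\<^sub>j\<^sub>\<noteq>\<^sub>i W\<^sub>j / (z - x\<^sub>j))\<close>. These maps are decoupled: each acts on a single
  variable.
  
  With \<open>r = R / (1 + b R)\<close> the bound on \<open>\<parallel>w\<parallel>\<close> reads \<open>s = r (1 - r) / (1 + (a - 1) r)\<close>. By Hoelder's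
  inequality, \<open>w\<^sub>i \<le> s\<close> and \<open>\<Sum>\<^sub>j\<^sub>\<noteq>\<^sub>i w\<^sub>j \<le> a s\<close>, and these two bounds imply that \<open>g\<^sub>i\<close> is dominated, on discs
  whose radius is measured in units of \<open>d\<^sub>i\<close>, by the real function
  \<open>\<phi>(t) = s (1 - t) / (1 - t - a s)\<close>. The value \<open>s\<close> is exactly the one for which \<open>\<phi>(r) = r\<close>. The iterates of
  \<open>\<phi>\<close> from \<open>0\<close> increase and stay below \<open>r\<close>, so those of \<open>g\<^sub>i\<close> from \<open>x\<^sub>i\<close> stay in the disc of radius
  \<open>r d\<^sub>i\<close>, and the values of \<open>f\<close> along them tend to \<open>0\<close> (\<open>iterates_majorized\<close>). The
  majorant takes the place of a contraction constant, which is not available in the extreme case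
  \<open>R = 1 / (1 - b + sqrt a)\<close>, where \<open>\<phi>'(r) = 1\<close>.
  
  In a field that is not complete the iterates may have no limit to appeal to. However, since \<open>f\<close> splits
  into finitely many linear factors, a closed disc on which \<open>|f|\<close> takes arbitrarily small values contains a root
  (\<open>root_in_ball_of_approximate_roots\<close>). Being a fixed point of \<open>g\<^sub>i\<close>, the root \<open>\<xi>\<^sub>i\<close> found in this way satisfies
  \<open>|\<xi>\<^sub>i - x\<^sub>i| / d\<^sub>i \<le> w\<^sub>i r / s\<close>, whence \<open>\<parallel>(x - \<xi>) / d\<parallel> \<le> \<parallel>w\<parallel> r / s \<le> r\<close>, strictly if \<open>\<parallel>w\<parallel> < s\<close>
  (\<open>roots_near_approximation\<close>).
  
  It remains to replace \<open>d(x)\<close> by \<open>d(\<xi>)\<close>. Hoelder's inequality for two indices, which is where \<open>b\<close> comes from, yields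
  \<open>|\<xi>\<^sub>i - \<xi>\<^sub>j| \<ge> (1 - b r) |x\<^sub>i - x\<^sub>j|\<close> (\<open>min_dist_perturbation\<close>). Hence the \<open>n\<close> roots \<open>\<xi>\<^sub>i\<close> are distinct, so
  they are all the roots of \<open>f\<close> and are simple, and \<open>\<parallel>(x - \<xi>) / d(\<xi>)\<parallel> \<le> r / (1 - b r) = R\<close>.
\<close>

section \<open>The p-norm and the inequality of Hoelder\<close>

lemma conjugate_exponent_reciprocal:
  assumes "1 \<le> p" and "conjugate_exponent p q"
  shows "enn2real (1 / q) = (if p = \<infinity> then 1 else 1 - 1 / enn2real p)"
proof (cases p)
  case (real P)
  with assms have P: "1 \<le> P"
    by (simp flip: ennreal_1)
  then have inv: "1 / p = ennreal (1 / P)"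
    using real by (simp add: divide_ennreal flip: ennreal_1)
  have sum: "1 / p + 1 / q = 1"
    using assms by (simp add: conjugate_exponent_def)
  then have "1 / q = 1 - ennreal (1 / P)"
    using inv by (metis ennreal_add_diff_cancel_left ennreal_neq_top infinity_ennreal_def)
  also have "\<dots> = ennreal (1 - 1 / P)"
    using P by (simp add: ennreal_minus flip: ennreal_1)
  finally show ?thesis
    using real P by simp
next
  case top
  with assms show ?thesis
    by (simp add: conjugate_exponent_def)
qed

lemma p_norm_nonneg:
  fixes u :: "real ^ 'n"
  shows "0 \<le> p_norm p u"
proof (cases "p = \<infinity>")
  case True
  have "0 \<le> \<bar>u $ undefined\<bar>" by simp
  also have "\<dots> \<le> Max (range (\<lambda>i. \<bar>u $ i\<bar>))" by (rule Max_ge) auto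
  finally show ?thesis using True by (simp add: p_norm_def)
qed (simp add: p_norm_def)

lemma p_norm_le_scaled:
  fixes u v :: "real ^ 'n"
  assumes "1 \<le> p" and "0 \<le> c" and le: "\<And>i. \<bar>u $ i\<bar> \<le> c * \<bar>v $ i\<bar>"
  shows "p_norm p u \<le> c * p_norm p v"
proof (cases p)
  case (real P)
  with assms have P: "1 \<le> P"
    by (simp flip: ennreal_1)
  have "(\<Sum>i\<in>UNIV. \<bar>u $ i\<bar> powr P) \<le> (\<Sum>i\<in>UNIV. (c * \<bar>v $ i\<bar>) powr P)"
    using le P by (intro sum_mono powr_mono2) auto
  also have "\<dots> = c powr P * (\<Sum>i\<in>UNIV. \<bar>v $ i\<bar> powr P)"
    using \<open>0 \<le> c\<close> by (simp add: powr_mult sum_distrib_left)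
  finally have "(\<Sum>i\<in>UNIV. \<bar>u $ i\<bar> powr P) powr (1 / P)
      \<le> (c powr P * (\<Sum>i\<in>UNIV. \<bar>v $ i\<bar> powr P)) powr (1 / P)"
    using P by (intro powr_mono2) (auto intro: sum_nonneg)
  also have "\<dots> = c * (\<Sum>i\<in>UNIV. \<bar>v $ i\<bar> powr P) powr (1 / P)"
    using P \<open>0 \<le> c\<close> by (simp add: powr_mult powr_powr sum_nonneg)
  finally show ?thesis
    using real P by (simp add: p_norm_def)
next
  case top
  have "\<bar>u $ i\<bar> \<le> c * Max (range (\<lambda>i. \<bar>v $ i\<bar>))" for i
    by (rule order_trans[OF le mult_left_mono[OF Max_ge \<open>0 \<le> c\<close>]]) auto
  then show ?thesis
    using top by (auto simp: p_norm_def)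
qed

text \<open>
  This is Jensen's inequality for \<open>t \<mapsto> t powr P\<close>. Vanishing entries are discarded beforehand, as
  convexity is used on the open half-line only.
\<close>

lemma sum_le_card_powr_power_sum:
  fixes v :: "'i \<Rightarrow> real"
  assumes "finite A" and "1 \<le> P" and nonneg: "\<And>i. i \<in> A \<Longrightarrow> 0 \<le> v i"
  shows "(\<Sum>i\<in>A. v i) \<le> real (card A) powr (1 - 1 / P) * (\<Sum>i\<in>A. v i powr P) powr (1 / P)"
proof -
  define B where "B = {i \<in> A. v i \<noteq> 0}"
  have B: "finite B" "B \<subseteq> A" "\<And>i. i \<in> B \<Longrightarrow> 0 < v i"
    using assms(1) nonneg by (auto simp: B_def less_le)
  have drop: "(\<Sum>i\<in>A. v i) = (\<Sum>i\<in>B. v i)" "(\<Sum>i\<in>A. v i powr P) = (\<Sum>i\<in>B. v i powr P)"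
    using assms(1) by (auto intro!: sum.mono_neutral_right simp: B_def)
  show ?thesis
  proof (cases "B = {}")
    case True
    then show ?thesis by (simp add: drop)
  next
    case False
    define m where "m = real (card B)"
    have m: "0 < m"
      using False B(1) by (simp add: m_def card_gt_0_iff)
    define S where "S = (\<Sum>i\<in>B. v i powr P)"
    have S: "0 \<le> S" by (simp add: S_def sum_nonneg)
    have "(\<Sum>i\<in>B. (1 / m) *\<^sub>R v i) powr P \<le> (\<Sum>i\<in>B. (1 / m) * v i powr P)"
      using B m False
      by (intro convex_on_sum[OF _ _ powr_convex[OF assms(2)]]) (auto simp: m_def)
    then have jensen: "((\<Sum>i\<in>B. v i) / m) powr P \<le> S / m"
      by (simp add: S_def sum_divide_distrib)
    have sum0: "0 \<le> (\<Sum>i\<in>B. v i)"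
      using B(3) by (intro sum_nonneg) (auto intro: less_imp_le)
    have "(\<Sum>i\<in>B. v i) / m = (((\<Sum>i\<in>B. v i) / m) powr P) powr (1 / P)"
      using assms(2) m sum0 by (simp add: powr_powr)
    also have "\<dots> \<le> (S / m) powr (1 / P)"
      using jensen assms(2) by (intro powr_mono2) auto
    finally have "(\<Sum>i\<in>B. v i) \<le> m * (S / m) powr (1 / P)"
      using m by (simp add: field_simps)
    also have "\<dots> = m powr (1 - 1 / P) * S powr (1 / P)"
      using m S by (simp add: powr_divide powr_diff)
    also have "\<dots> \<le> real (card A) powr (1 - 1 / P) * S powr (1 / P)"
      using B assms(1,2) by (intro mult_right_mono powr_mono2) (auto simp: m_def card_mono)
    finally show ?thesis by (simp add: drop S_def)
  qed
qed

text \<open>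
  Three index sets matter below: a singleton bounds one entry by the norm, a pair produces the
  constant \<open>b\<close>, and the complement of a point produces the constant \<open>a\<close>.
\<close>

lemma sum_abs_le_p_norm:
  fixes u :: "real ^ 'n"
  assumes "1 \<le> p" and "conjugate_exponent p q"
  shows "(\<Sum>i\<in>A. \<bar>u $ i\<bar>) \<le> real (card A) powr enn2real (1 / q) * p_norm p u"
proof (cases p)
  case (real P)
  with assms have P: "1 \<le> P"
    by (simp flip: ennreal_1)
  have "(\<Sum>i\<in>A. \<bar>u $ i\<bar>)
      \<le> real (card A) powr (1 - 1 / P) * (\<Sum>i\<in>A. \<bar>u $ i\<bar> powr P) powr (1 / P)"
    using P by (intro sum_le_card_powr_power_sum) auto
  also have "\<dots> \<le> real (card A) powr (1 - 1 / P) * (\<Sum>i\<in>UNIV. \<bar>u $ i\<bar> powr P) powr (1 / P)"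
    using P by (intro mult_left_mono powr_mono2 sum_mono2) (auto intro: sum_nonneg)
  finally show ?thesis
    using real P conjugate_exponent_reciprocal[OF assms] by (simp add: p_norm_def)
next
  case top
  have "(\<Sum>i\<in>A. \<bar>u $ i\<bar>) \<le> real (card A) * Max (range (\<lambda>i. \<bar>u $ i\<bar>))"
    by (rule sum_bounded_above) (auto intro: Max_ge)
  then show ?thesis
    using top conjugate_exponent_reciprocal[OF assms] by (simp add: p_norm_def)
qed

section \<open>Polynomials\<close>

lemma factorization_of_distinct_roots:
  fixes f :: "'a::field poly" and \<xi> :: "'a ^ 'n"
  assumes "CARD('n) = degree f" and "inj (\<lambda>i. \<xi> $ i)" and "\<And>i. poly f (\<xi> $ i) = 0"
  shows "f = smult (lead_coeff f) (\<Prod>i\<in>UNIV. [:- \<xi> $ i, 1:])" (is "_ = ?g")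
proof (rule poly_eqI_degree_lead_coeff)
  have deg: "degree (\<Prod>i\<in>(UNIV :: 'n set). [:- \<xi> $ i, 1:]) = degree f"
    using assms(1) by (subst degree_prod_eq_sum_degree) auto
  have "lead_coeff (\<Prod>i\<in>(UNIV :: 'n set). [:- \<xi> $ i, 1:]) = 1"
    by (subst lead_coeff_prod) simp
  with deg show "coeff f (degree f) = coeff ?g (degree f)"
    by simp
  show "degree f \<le> card (range (\<lambda>i. \<xi> $ i))"
    using assms(1,2) by (simp add: card_image)
  show "degree ?g \<le> degree f"
    using deg by (metis degree_smult_le)
  show "poly f z = poly ?g z" if "z \<in> range (\<lambda>i. \<xi> $ i)" for z
    using that assms(3) by (auto simp: poly_prod)
qed simp

lemma only_simple_zeros_of_distinct_factors:
  fixes f :: "'a::field poly" and \<xi> :: "'a ^ 'n"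
  assumes "f \<noteq> 0" and f: "f = smult (lead_coeff f) (\<Prod>i\<in>UNIV. [:- \<xi> $ i, 1:])"
    and "inj (\<lambda>i. \<xi> $ i)"
  shows "only_simple_zeros f"
  unfolding only_simple_zeros_def
proof (intro allI impI)
  fix z assume "poly f z = 0"
  then have "poly (smult (lead_coeff f) (\<Prod>i\<in>UNIV. [:- \<xi> $ i, 1:])) z = 0"
    using f by metis
  then obtain k where k: "z = \<xi> $ k"
    using \<open>f \<noteq> 0\<close> by (auto simp: poly_prod)
  define g where "g = (\<Prod>i\<in>UNIV - {k}. [:- \<xi> $ i, 1:])"
  have g: "poly g z \<noteq> 0"
    using assms(3) by (auto simp: g_def poly_prod k dest: injD)
  have "(\<Prod>i\<in>UNIV. [:- \<xi> $ i, 1:]) = [:- z, 1:] * g"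
    by (simp add: g_def k prod.remove[of UNIV k])
  then have "order z f = order z ([:- z, 1:] * g)"
    using \<open>f \<noteq> 0\<close> f by (metis leading_coeff_0_iff order_smult)
  also have "\<dots> = order z [:- z, 1:] + order z g"
  proof (rule order_mult)
    show "[:- z, 1:] * g \<noteq> 0"
      using g by (metis mult_eq_0_iff one_neq_zero pCons_eq_0_iff poly_0)
  qed
  also have "\<dots> = 1"
    using order_0I[OF g] order_power_n_n[of z 1] by simp
  finally show "order z f = 1" .
qed

text \<open>
  Both sides have the same leading coefficient and agree at the \<open>n\<close> distinct points \<open>x\<^sub>k\<close>: there only the
  summand with index \<open>k\<close> survives, and \<open>W\<^sub>k\<close> is defined so that it has the value of \<open>f\<close>.
\<close>

lemma weierstrass_correction_expansion:
  fixes f :: "'a::field poly" and x :: "'a ^ 'n"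
  assumes "CARD('n) = degree f" and "inj (\<lambda>i. x $ i)"
  shows "poly f z = lead_coeff f * ((\<Prod>j\<in>UNIV. z - x $ j)
    + (\<Sum>i\<in>UNIV. weierstrass_correction f x $ i * (\<Prod>j\<in>UNIV - {i}. z - x $ j)))"
proof -
  define P where "P = (\<Prod>j\<in>(UNIV :: 'n set). [:- x $ j, 1:])"
  define Q where "Q = (\<Sum>i\<in>(UNIV :: 'n set). smult (weierstrass_correction f x $ i)
    (\<Prod>j\<in>UNIV - {i}. [:- x $ j, 1:]))"
  have n: "0 < degree f"
    using assms(1) by (metis zero_less_card_finite)
  then have "f \<noteq> 0" by auto
  have degP: "degree P = degree f"
    using assms(1) by (simp add: P_def degree_prod_eq_sum_degree)
  have leadP: "lead_coeff P = 1"
    by (simp add: P_def lead_coeff_prod)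
  have "degree (smult c (\<Prod>j\<in>UNIV - {i}. [:- x $ j, 1:])) < degree f" for i c
    using n assms(1) by (simp add: degree_prod_eq_sum_degree card_Diff_singleton)
  then have degQ: "degree Q < degree f"
    unfolding Q_def using n by (intro degree_sum_less) auto
  have "f = smult (lead_coeff f) (P + Q)"
  proof (rule poly_eqI_degree_lead_coeff)
    show "coeff f (degree f) = coeff (smult (lead_coeff f) (P + Q)) (degree f)"
      using degP leadP degQ by (simp add: coeff_eq_0)
    show "degree f \<le> card (range (\<lambda>i. x $ i))"
      using assms by (simp add: card_image)
    show "degree (smult (lead_coeff f) (P + Q)) \<le> degree f"
      using degP degQ by (intro order_trans[OF degree_smult_le] degree_add_le) auto
    show "poly f z = poly (smult (lead_coeff f) (P + Q)) z" if z: "z \<in> range (\<lambda>i. x $ i)" for z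
    proof -
      obtain k where k: "z = x $ k" using z by auto
      have ne: "(\<Prod>j\<in>UNIV - {k}. x $ k - x $ j) \<noteq> 0"
        using assms(2) by (auto dest: injD)
      have "poly Q z = (\<Sum>i\<in>UNIV. weierstrass_correction f x $ i
          * (\<Prod>j\<in>UNIV - {i}. x $ k - x $ j))"
        by (simp add: Q_def poly_sum poly_prod k)
      also have "\<dots> = (\<Sum>i\<in>{k}. weierstrass_correction f x $ i
          * (\<Prod>j\<in>UNIV - {i}. x $ k - x $ j))"
        by (rule sum.mono_neutral_right) auto
      finally have "poly Q z = poly f z / lead_coeff f"
        using ne by (simp add: weierstrass_correction_def k)
      moreover have "poly P z = 0"
        by (auto simp: P_def poly_prod k)
      ultimately show ?thesis
        using \<open>f \<noteq> 0\<close> by simp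
    qed
  qed simp
  then have "poly f z = poly (smult (lead_coeff f) (P + Q)) z"
    by metis
  then show ?thesis
    by (simp add: P_def Q_def poly_sum poly_prod)
qed


section \<open>Absolute values and minimal distances\<close>

context absolute_value
begin

lemma av_zero [simp]: "av 0 = 0"
  by (simp add: av_eq_0_iff)

lemma av_pos: "x \<noteq> 0 \<Longrightarrow> 0 < av x"
  using av_nonneg[of x] av_eq_0_iff[of x] by linarith

lemma av_one [simp]: "av 1 = 1"
  using av_mult[of 1 1] av_eq_0_iff[of 1] by simp

lemma av_minus [simp]: "av (- x) = av x"
proof -
  have "av (- 1) * av (- 1) = 1"
    using av_mult[of "- 1" "- 1"] by simp
  then have "av (- 1) = 1"
    using av_nonneg[of "- 1"] by (metis abs_of_nonneg abs_square_eq_1 power2_eq_square)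
  then show ?thesis
    using av_mult[of "- 1" x] by simp
qed

lemma av_diff_commute: "av (x - y) = av (y - x)"
  using av_minus[of "x - y"] by simp

lemma av_diff_triangle: "av (x - z) \<le> av (x - y) + av (y - z)"
  using av_triangle[of "x - y" "y - z"] by simp

lemma av_divide: "av (x / y) = av x / av y"
proof (cases "y = 0")
  case False
  then show ?thesis
    using av_mult[of "x / y" y] av_pos[of y] by (simp add: field_simps)
qed simp

lemma av_sum_le: "av (sum f A) \<le> (\<Sum>i\<in>A. av (f i))"
  by (induction A rule: infinite_finite_induct) (auto intro: order_trans[OF av_triangle])

lemma av_prod: "av (prod f A) = (\<Prod>i\<in>A. av (f i))"
  by (induction A rule: infinite_finite_induct) (auto simp: av_mult)

lemma power_le_av_prod_mset:
  assumes "0 \<le> e" and "\<And>y. y \<in># A \<Longrightarrow> e \<le> av (z - y)"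
  shows "e ^ size A \<le> av (\<Prod>y\<in>#A. z - y)"
  using assms(2)
proof (induction A)
  case (add y A)
  then show ?case
    using \<open>0 \<le> e\<close> by (auto simp: av_mult intro!: mult_mono av_nonneg)
qed simp

end

text \<open>
  This replaces completeness. If all roots lay outside the ball, then, being finitely many, they would
  have distance at least some \<open>e > 0\<close> from it, and the factorization of \<open>f\<close> would bound \<open>|f|\<close> from
  below on the ball by \<open>|lead_coeff f| e ^ degree f\<close>.
\<close>

lemma root_in_ball_of_approximate_roots:
  fixes f :: "'a::alg_closed_field poly"
  assumes "absolute_value av" and "f \<noteq> 0"
    and ball: "\<And>k. av (z k - c) \<le> \<rho>"
    and lim: "(\<lambda>k::nat. av (poly f (z k))) \<longlonglongrightarrow> 0"
  shows "\<exists>\<zeta>. poly f \<zeta> = 0 \<and> av (\<zeta> - c) \<le> \<rho>"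
proof (rule ccontr)
  assume none: "\<nexists>\<zeta>. poly f \<zeta> = 0 \<and> av (\<zeta> - c) \<le> \<rho>"
  interpret absolute_value av by fact
  obtain A where A: "f = smult (lead_coeff f) (\<Prod>y\<in>#A. [:- y, 1:])"
    using alg_closed_imp_factorization[OF \<open>f \<noteq> 0\<close>] by blast
  have eval: "poly f y = lead_coeff f * (\<Prod>\<zeta>\<in>#A. y - \<zeta>)" for y
    by (subst A) (simp add: poly_prod_mset multiset.map_comp o_def)
  have root: "poly f \<zeta> = 0" if "\<zeta> \<in># A" for \<zeta>
    using that by (auto simp: eval prod_mset_zero_iff)
  \<comment> \<open>The element \<open>1\<close> keeps the minimum meaningful when there are no roots.\<close>
  define e where "e = Min (insert 1 ((\<lambda>\<zeta>. av (\<zeta> - c) - \<rho>) ` set_mset A))"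
  have "0 < e"
    unfolding e_def using none root by (subst Min_gr_iff) (auto simp: not_le)
  have "e \<le> av (z k - \<zeta>)" if "\<zeta> \<in># A" for k \<zeta>
  proof -
    have "e \<le> av (\<zeta> - c) - \<rho>"
      unfolding e_def using that by (intro Min_le) auto
    then show ?thesis
      using ball[of k] av_diff_triangle[of \<zeta> c "z k"] av_diff_commute[of \<zeta> "z k"] by linarith
  qed
  then have "e ^ size A \<le> av (\<Prod>\<zeta>\<in>#A. z k - \<zeta>)" for k
    using \<open>0 < e\<close> by (intro power_le_av_prod_mset) auto
  then have "av (lead_coeff f) * e ^ size A \<le> av (poly f (z k))" for k
    by (simp add: eval av_mult mult_left_mono av_nonneg)
  then have "av (lead_coeff f) * e ^ size A \<le> 0"
    using lim by (intro LIMSEQ_le_const) auto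
  moreover have "0 < av (lead_coeff f) * e ^ size A"
    using \<open>0 < e\<close> \<open>f \<noteq> 0\<close> by (simp add: av_pos)
  ultimately show False by simp
qed

lemma min_dist_le:
  fixes x :: "'a::field ^ 'n"
  assumes "j \<noteq> i"
  shows "min_dist av x $ i \<le> av (x $ i - x $ j)"
  using assms by (auto simp: min_dist_def intro: Min_le)

lemma min_dist_attained:
  fixes x :: "'a::field ^ 'n"
  assumes "2 \<le> CARD('n)"
  obtains j where "j \<noteq> i" and "min_dist av x $ i = av (x $ i - x $ j)"
proof -
  have "card (UNIV - {i}) \<noteq> 0"
    using assms by (simp add: card_Diff_singleton)
  then have "UNIV - {i} \<noteq> {}"
    by (metis card.empty)
  then have "min_dist av x $ i \<in> (\<lambda>j. av (x $ i - x $ j)) ` (UNIV - {i})"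
    unfolding min_dist_def vec_lambda_beta by (intro Min_in) auto
  then show ?thesis
    using that by auto
qed

section \<open>A decoupled fixed-point map and its majorant\<close>

text \<open>
  One index \<open>i\<close> is singled out. The p-norm enters only through two bounds on the scaled corrections, \<open>s\<close> for
  the entry \<open>i\<close> and \<open>\<sigma>\<close> for the sum of the others. In the application \<open>\<sigma>\<close> is \<open>a * s\<close>.
\<close>

locale weierstrass_map = absolute_value av
  for av :: "'a::alg_closed_field \<Rightarrow> real" +
  fixes x W :: "'n::finite \<Rightarrow> 'a" and D :: "'n \<Rightarrow> real" and i :: 'n and s \<sigma> :: real
  assumes D_pos: "0 < D j"
    and D_le: "j \<noteq> k \<Longrightarrow> D j \<le> av (x j - x k)"
    and s_nonneg: "0 \<le> s"
    and W_i: "av (W i) \<le> s * D i"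
    and W_others: "(\<Sum>j\<in>UNIV - {i}. av (W j) / D j) \<le> \<sigma>"
begin

definition denominator :: "'a \<Rightarrow> 'a" where
  "denominator z = 1 + (\<Sum>j\<in>UNIV - {i}. W j / (z - x j))"

definition step :: "'a \<Rightarrow> 'a" where
  "step z = x i - W i / denominator z"

definition majorant :: "real \<Rightarrow> real" where
  "majorant t = s * (1 - t) / (1 - t - \<sigma>)"

lemma sigma_nonneg: "0 \<le> \<sigma>"
  using W_others by (rule order_trans[rotated]) (auto intro!: sum_nonneg divide_nonneg_pos av_nonneg D_pos)

lemma radius_nonneg: "av (z - x i) \<le> t * D i \<Longrightarrow> 0 \<le> t"
  using order_trans[OF av_nonneg, of "z - x i" "t * D i"] D_pos[of i] by (simp add: zero_le_mult_iff)

text \<open>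
  The point \<open>x\<^sub>j\<close> is at distance at least \<open>D i\<close> and at least \<open>D j\<close> from \<open>x\<^sub>i\<close>. The second bound turns
  \<open>W\<^sub>j / (z - x\<^sub>j)\<close> into \<open>W\<^sub>j / D\<^sub>j\<close>, which \<open>\<sigma>\<close> controls; the first one rescales differences to the unit
  \<open>D i\<close> in Lipschitz estimates.
\<close>

lemma distance_to_other_point:
  assumes z: "av (z - x i) \<le> t * D i" and "t < 1" and "j \<noteq> i"
  shows "(1 - t) * D i \<le> av (z - x j)" and "(1 - t) * D j \<le> av (z - x j)"
proof -
  have "t * D i \<le> t * av (x i - x j)"
    using radius_nonneg[OF z] D_le[of i j] \<open>j \<noteq> i\<close> by (intro mult_left_mono) auto
  then have *: "(1 - t) * av (x i - x j) \<le> av (z - x j)"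
    using z av_diff_triangle[of "x i" "x j" z] av_diff_commute[of z "x i"]
    by (simp add: algebra_simps)
  have "(1 - t) * D i \<le> (1 - t) * av (x i - x j)"
    using D_le[of i j] assms by (intro mult_left_mono) auto
  with * show "(1 - t) * D i \<le> av (z - x j)" by linarith
  have "(1 - t) * D j \<le> (1 - t) * av (x i - x j)"
    using D_le[of j i] av_diff_commute[of "x i" "x j"] assms by (intro mult_left_mono) auto
  with * show "(1 - t) * D j \<le> av (z - x j)" by linarith
qed

lemma away_from_other_points:
  assumes "av (z - x i) \<le> t * D i" and "t < 1" and "j \<noteq> i"
  shows "0 < av (z - x j)" and "z \<noteq> x j"
proof -
  have "0 < (1 - t) * D i" using assms D_pos by simp
  then show "0 < av (z - x j)"
    using distance_to_other_point(1)[OF assms] by linarith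
  then show "z \<noteq> x j" by auto
qed

lemma av_denominator_sum_le:
  assumes z: "av (z - x i) \<le> t * D i" and "t < 1"
  shows "av (\<Sum>j\<in>UNIV - {i}. W j / (z - x j)) \<le> \<sigma> / (1 - t)"
proof -
  have "av (\<Sum>j\<in>UNIV - {i}. W j / (z - x j)) \<le> (\<Sum>j\<in>UNIV - {i}. av (W j / (z - x j)))"
    by (rule av_sum_le)
  also have "\<dots> \<le> (\<Sum>j\<in>UNIV - {i}. av (W j) / D j / (1 - t))"
  proof (rule sum_mono)
    fix j assume "j \<in> UNIV - {i}"
    then have "av (W j) / av (z - x j) \<le> av (W j) / ((1 - t) * D j)"
      using distance_to_other_point(2)[OF assms, of j] D_pos[of j] assms
        away_from_other_points(1)[OF assms, of j]
      by (intro divide_left_mono av_nonneg) auto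
    then show "av (W j / (z - x j)) \<le> av (W j) / D j / (1 - t)"
      by (simp add: av_divide mult.commute)
  qed
  also have "\<dots> \<le> \<sigma> / (1 - t)"
    unfolding sum_divide_distrib[symmetric]
    using W_others \<open>t < 1\<close> by (intro divide_right_mono) auto
  finally show ?thesis .
qed

lemma av_denominator_ge:
  assumes "av (z - x i) \<le> t * D i" and "t < 1"
  shows "(1 - t - \<sigma>) / (1 - t) \<le> av (denominator z)"
proof -
  let ?S = "\<Sum>j\<in>UNIV - {i}. W j / (z - x j)"
  have "1 \<le> av (denominator z) + av ?S"
    using av_triangle[of "denominator z" "- ?S"] by (simp add: denominator_def)
  moreover have "(1 - t - \<sigma>) / (1 - t) = 1 - \<sigma> / (1 - t)"
    using \<open>t < 1\<close> by (simp add: field_simps)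
  ultimately show ?thesis
    using av_denominator_sum_le[OF assms] by linarith
qed

lemma denominator_nonzero:
  assumes "av (z - x i) \<le> t * D i" and "t + \<sigma> < 1"
  shows "denominator z \<noteq> 0"
proof -
  have "t < 1" using assms sigma_nonneg by simp
  moreover from this have "0 < (1 - t - \<sigma>) / (1 - t)"
    using assms by simp
  ultimately show ?thesis
    using av_denominator_ge[OF assms(1)] by auto
qed

lemma av_step_diff_center_le:
  assumes "av (z - x i) \<le> t * D i" and "t + \<sigma> < 1"
  shows "av (step z - x i) \<le> av (W i) * ((1 - t) / (1 - t - \<sigma>))"
proof -
  have "t < 1" using assms sigma_nonneg by simp
  have pos: "0 < (1 - t - \<sigma>) / (1 - t)"
    using \<open>t < 1\<close> assms by simp
  have "av (step z - x i) = av (W i) / av (denominator z)"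
    by (simp add: step_def av_divide)
  also have "\<dots> \<le> av (W i) / ((1 - t - \<sigma>) / (1 - t))"
    using av_denominator_ge[OF assms(1) \<open>t < 1\<close>] pos
    by (intro divide_left_mono av_nonneg mult_pos_pos) linarith+
  finally show ?thesis by simp
qed

text \<open>
  The right-hand side is the Lipschitz bound obtained for the step map below, which makes
  \<open>majorant\<close> an exact majorant.
\<close>

lemma majorant_diff:
  assumes "t + \<sigma> < 1" and "t' + \<sigma> < 1"
  shows "majorant t - majorant t' = s * \<sigma> * (t - t') / ((1 - t - \<sigma>) * (1 - t' - \<sigma>))"
  using assms by (simp add: majorant_def field_simps)

lemma majorant_mono:
  assumes "t' \<le> t" and "t + \<sigma> < 1"
  shows "majorant t' \<le> majorant t"
proof -
  have "0 \<le> s * \<sigma> * (t - t') / ((1 - t - \<sigma>) * (1 - t' - \<sigma>))"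
    using assms s_nonneg sigma_nonneg by (intro divide_nonneg_nonneg mult_nonneg_nonneg) auto
  then show ?thesis
    using majorant_diff[of t t'] assms by simp
qed

text \<open>
  In \<open>1 / (z' - x\<^sub>j) - 1 / (z - x\<^sub>j) = (z - z') / ((z - x\<^sub>j) (z' - x\<^sub>j))\<close> one factor of the
  denominator is compared with \<open>D j\<close> and the other with \<open>D i\<close>.
\<close>

lemma av_denominator_diff_le:
  assumes z: "av (z - x i) \<le> t * D i" and "t < 1"
    and z': "av (z' - x i) \<le> t' * D i" and "t' < 1"
    and zz': "av (z - z') \<le> (t - t') * D i"
  shows "av (denominator z' - denominator z) \<le> \<sigma> * (t - t') / ((1 - t) * (1 - t'))"
proof -
  let ?I = "UNIV - {i}"
  have "denominator z' - denominator z = (\<Sum>j\<in>?I. W j / (z' - x j) - W j / (z - x j))"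
    by (simp add: denominator_def sum_subtractf)
  then have "av (denominator z' - denominator z)
      \<le> (\<Sum>j\<in>?I. av (W j / (z' - x j) - W j / (z - x j)))"
    using av_sum_le by simp
  also have "\<dots> \<le> (\<Sum>j\<in>?I. av (W j) / D j * ((t - t') / ((1 - t) * (1 - t'))))"
  proof (rule sum_mono)
    fix j assume "j \<in> ?I"
    then have "j \<noteq> i" by simp
    note far = away_from_other_points[OF z \<open>t < 1\<close> \<open>j \<noteq> i\<close>]
      away_from_other_points[OF z' \<open>t' < 1\<close> \<open>j \<noteq> i\<close>]
    have "W j / (z' - x j) - W j / (z - x j) = W j * (z - z') / ((z - x j) * (z' - x j))"
      using far by (simp add: field_simps)
    then have "av (W j / (z' - x j) - W j / (z - x j))
        = av (W j) * av (z - z') / (av (z - x j) * av (z' - x j))"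
      by (simp add: av_divide av_mult)
    also have "\<dots> \<le> av (W j) * ((t - t') * D i) / (((1 - t) * D j) * ((1 - t') * D i))"
    proof (rule frac_le)
      show "0 \<le> av (W j) * ((t - t') * D i)"
        using order_trans[OF av_nonneg zz'] av_nonneg by simp
      show "av (W j) * av (z - z') \<le> av (W j) * ((t - t') * D i)"
        using zz' by (intro mult_left_mono av_nonneg)
      show "0 < (1 - t) * D j * ((1 - t') * D i)"
        using D_pos assms by simp
      show "(1 - t) * D j * ((1 - t') * D i) \<le> av (z - x j) * av (z' - x j)"
        using distance_to_other_point(2)[OF z \<open>t < 1\<close> \<open>j \<noteq> i\<close>]
          distance_to_other_point(1)[OF z' \<open>t' < 1\<close> \<open>j \<noteq> i\<close>] D_pos[of i] assms
        by (intro mult_mono av_nonneg) auto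
    qed
    also have "\<dots> = av (W j) / D j * ((t - t') / ((1 - t) * (1 - t')))"
      using D_pos[of i] by simp
    finally show "av (W j / (z' - x j) - W j / (z - x j))
      \<le> av (W j) / D j * ((t - t') / ((1 - t) * (1 - t')))" .
  qed
  also have "\<dots> = (\<Sum>j\<in>?I. av (W j) / D j) * ((t - t') / ((1 - t) * (1 - t')))"
    by (rule sum_distrib_right[symmetric])
  also have "\<dots> \<le> \<sigma> * ((t - t') / ((1 - t) * (1 - t')))"
  proof (rule mult_right_mono[OF W_others])
    have "0 \<le> (t - t') * D i"
      using order_trans[OF av_nonneg zz'] .
    then have "0 \<le> t - t'"
      using D_pos[of i] by (simp add: zero_le_mult_iff)
    then show "0 \<le> (t - t') / ((1 - t) * (1 - t'))"
      using assms by simp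
  qed
  finally show ?thesis by simp
qed

lemma av_step_diff_le_majorant_diff:
  assumes z: "av (z - x i) \<le> t * D i" and t: "t + \<sigma> < 1"
    and z': "av (z' - x i) \<le> t' * D i" and t': "t' + \<sigma> < 1"
    and zz': "av (z - z') \<le> (t - t') * D i"
  shows "av (step z - step z') \<le> (majorant t - majorant t') * D i"
proof -
  have lt1: "t < 1" "t' < 1" using t t' sigma_nonneg by auto
  note nz = denominator_nonzero[OF z t] denominator_nonzero[OF z' t']
  have "step z - step z' = W i * (denominator z - denominator z') / (denominator z * denominator z')"
    using nz by (simp add: step_def field_simps)
  then have "av (step z - step z')
      = av (W i) * av (denominator z' - denominator z) / (av (denominator z) * av (denominator z'))"
    by (simp add: av_divide av_mult av_diff_commute)
  also have "\<dots> \<le> s * D i * (\<sigma> * (t - t') / ((1 - t) * (1 - t')))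
      / (((1 - t - \<sigma>) / (1 - t)) * ((1 - t' - \<sigma>) / (1 - t')))"
  proof (rule frac_le)
    have bound: "av (denominator z' - denominator z) \<le> \<sigma> * (t - t') / ((1 - t) * (1 - t'))"
      using av_denominator_diff_le[OF z lt1(1) z' lt1(2) zz'] .
    show "0 \<le> s * D i * (\<sigma> * (t - t') / ((1 - t) * (1 - t')))"
      using order_trans[OF av_nonneg bound] s_nonneg D_pos[of i]
      by (intro mult_nonneg_nonneg) auto
    show "av (W i) * av (denominator z' - denominator z)
        \<le> s * D i * (\<sigma> * (t - t') / ((1 - t) * (1 - t')))"
      using W_i bound s_nonneg D_pos[of i] by (intro mult_mono av_nonneg) auto
    show "0 < (1 - t - \<sigma>) / (1 - t) * ((1 - t' - \<sigma>) / (1 - t'))"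
      using lt1 t t' by simp
    show "(1 - t - \<sigma>) / (1 - t) * ((1 - t' - \<sigma>) / (1 - t')) \<le> av (denominator z) * av (denominator z')"
      using av_denominator_ge[OF z lt1(1)] av_denominator_ge[OF z' lt1(2)] lt1 t t'
      by (intro mult_mono av_nonneg) auto
  qed
  also have "\<dots> = (majorant t - majorant t') * D i"
    using lt1 by (simp add: majorant_diff[OF t t'])
  finally show ?thesis .
qed

text \<open>
  Near \<open>x\<^sub>i\<close> this identifies the roots of the polynomial with the fixed points of \<open>step\<close>, and it
  bounds the value at \<open>z\<close> by a multiple of the displacement \<open>z - step z\<close>.
\<close>

lemma weierstrass_form_factorization:
  assumes z: "av (z - x i) \<le> t * D i" and t: "t + \<sigma> < 1"
  shows "(\<Prod>j\<in>UNIV. z - x j) + (\<Sum>k\<in>UNIV. W k * (\<Prod>j\<in>UNIV - {k}. z - x j))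
    = (\<Prod>j\<in>UNIV - {i}. z - x j) * denominator z * (z - step z)"
proof -
  let ?P = "\<Prod>j\<in>UNIV - {i}. z - x j"
  have lt1: "t < 1" using t sigma_nonneg by auto
  have "(\<Prod>j\<in>UNIV - {k}. z - x j) = ?P * ((z - x i) / (z - x k))" if "k \<noteq> i" for k
  proof -
    have "z \<noteq> x k"
      using away_from_other_points(2)[OF z lt1 that] .
    moreover have "(z - x k) * (\<Prod>j\<in>UNIV - {k}. z - x j) = (z - x i) * ?P"
      using prod.remove[of UNIV k "\<lambda>j. z - x j"] prod.remove[of UNIV i "\<lambda>j. z - x j"] by simp
    ultimately show ?thesis
      by (simp add: field_simps)
  qed
  then have "(\<Sum>k\<in>UNIV - {i}. W k * (\<Prod>j\<in>UNIV - {k}. z - x j))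
      = (\<Sum>k\<in>UNIV - {i}. ?P * (z - x i) * (W k / (z - x k)))"
    by (intro sum.cong) auto
  also have "\<dots> = ?P * (z - x i) * (denominator z - 1)"
    by (subst sum_distrib_left[symmetric]) (simp add: denominator_def)
  finally have "(\<Sum>k\<in>UNIV. W k * (\<Prod>j\<in>UNIV - {k}. z - x j))
      = W i * ?P + ?P * (z - x i) * (denominator z - 1)"
    by (simp add: sum.remove[of UNIV i])
  moreover have "(\<Prod>j\<in>UNIV. z - x j) = (z - x i) * ?P"
    by (simp add: prod.remove[of UNIV i])
  moreover have "denominator z * (z - step z) = denominator z * (z - x i) + W i"
    using denominator_nonzero[OF z t] by (simp add: step_def field_simps)
  ultimately show ?thesis
    by (simp only: mult.assoc) (simp add: algebra_simps)
qed

text \<open>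
  Kantorovich's majorant principle: each displacement of the iteration from \<open>x\<^sub>i\<close> is at most the
  corresponding increment of the real iteration from \<open>0\<close>, by induction along
  \<open>av_step_diff_le_majorant_diff\<close>, and monotonicity keeps the real iteration below its fixed point \<open>r\<close>.
\<close>

lemma iterates_majorized:
  assumes r: "0 \<le> r" "r + \<sigma> < 1" "majorant r = r"
  shows "av ((step ^^ k) (x i) - x i) \<le> (majorant ^^ k) 0 * D i \<and>
    av ((step ^^ Suc k) (x i) - (step ^^ k) (x i))
      \<le> ((majorant ^^ Suc k) 0 - (majorant ^^ k) 0) * D i \<and>
    (majorant ^^ k) 0 \<le> (majorant ^^ Suc k) 0 \<and> (majorant ^^ Suc k) 0 \<le> r"
proof (induction k)
  case 0
  have "\<sigma> < 1" using r by simp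
  have "av (step (x i) - x i) \<le> av (W i) * (1 / (1 - \<sigma>))"
    using av_step_diff_center_le[of "x i" 0] \<open>\<sigma> < 1\<close> by simp
  also have "\<dots> \<le> s * D i * (1 / (1 - \<sigma>))"
    using W_i \<open>\<sigma> < 1\<close> by (intro mult_right_mono) auto
  finally have "av (step (x i) - x i) \<le> majorant 0 * D i"
    by (simp add: majorant_def)
  moreover have "0 \<le> majorant 0"
    using s_nonneg \<open>\<sigma> < 1\<close> by (simp add: majorant_def)
  moreover have "majorant 0 \<le> r"
    using majorant_mono[of 0 r] r by simp
  ultimately show ?case by simp
next
  case (Suc k)
  let ?z = "\<lambda>k. (step ^^ k) (x i)" and ?t = "\<lambda>k. (majorant ^^ k) 0"
  have t: "?t k \<le> ?t (Suc k)" "?t (Suc k) \<le> r" using Suc by auto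
  have z: "av (?z (Suc k) - x i) \<le> ?t (Suc k) * D i"
    using Suc av_diff_triangle[of "?z (Suc k)" "x i" "?z k"] by (simp add: algebra_simps)
  moreover have "av (step (?z (Suc k)) - step (?z k)) \<le> (majorant (?t (Suc k)) - majorant (?t k)) * D i"
    using Suc t r z by (intro av_step_diff_le_majorant_diff) auto
  moreover have "majorant (?t k) \<le> majorant (?t (Suc k))"
    using t r by (intro majorant_mono) auto
  moreover have "majorant (?t (Suc k)) \<le> majorant r"
    using t r by (intro majorant_mono) auto
  ultimately show ?case
    using r by simp
qed

text \<open>
  The increments of the real iteration tend to \<open>0\<close> because it is monotone and bounded. Hence the
  displacements do, and so do the values of \<open>f\<close>. The root obtained in the closed disc of radius \<open>r D\<^sub>i\<close> is a fixed
  point of \<open>step\<close>, which upgrades the radius to one proportional to \<open>|W\<^sub>i|\<close>. This proportionality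
  lets the bounds for the single indices be combined into a bound for the p-norm.
\<close>

lemma root_near_point:
  assumes r: "0 \<le> r" "r + \<sigma> < 1" "majorant r = r"
    and "f \<noteq> 0"
    and f: "\<And>z. poly f z = lead_coeff f *
      ((\<Prod>j\<in>UNIV. z - x j) + (\<Sum>k\<in>UNIV. W k * (\<Prod>j\<in>UNIV - {k}. z - x j)))"
  shows "\<exists>\<zeta>. poly f \<zeta> = 0 \<and> av (\<zeta> - x i) \<le> av (W i) * ((1 - r) / (1 - r - \<sigma>))"
proof -
  define z t where "z k = (step ^^ k) (x i)" and "t k = (majorant ^^ k) 0" for k
  have it: "av (z k - x i) \<le> t k * D i" "av (z (Suc k) - z k) \<le> (t (Suc k) - t k) * D i"
    "t k \<le> t (Suc k)" "t (Suc k) \<le> r" for k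
    using iterates_majorized[OF r, of k] by (auto simp: z_def t_def)
  have lt1: "r < 1" using r sigma_nonneg by simp
  have t_le: "t k \<le> r" for k
    using it(3,4)[of k] by linarith
  have ball: "av (z k - x i) \<le> r * D i" for k
    using it(1)[of k] t_le[of k] D_pos[of i] by (meson less_imp_le mult_right_mono order_trans)
  have "incseq t"
    using it(3) by (rule incseq_SucI)
  then obtain l where l: "t \<longlonglongrightarrow> l"
    using t_le incseq_convergent[of t r] by blast
  then have "(\<lambda>k. t (Suc k) - t k) \<longlonglongrightarrow> 0"
    using tendsto_diff[OF LIMSEQ_Suc[OF l] l] by simp
  \<comment> \<open>\<open>C\<close> bounds the cofactor of the displacement in the factorization on the whole disc.\<close>
  define C where
    "C = av (lead_coeff f) * ((\<Prod>j\<in>UNIV - {i}. r * D i + av (x i - x j)) * (1 + \<sigma> / (1 - r)))"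
  have C_nonneg: "0 \<le> C"
    unfolding C_def using r lt1 sigma_nonneg D_pos[of i]
    by (intro mult_nonneg_nonneg prod_nonneg add_nonneg_nonneg av_nonneg) auto
  have "av (poly f (z k)) \<le> C * D i * (t (Suc k) - t k)" for k
  proof -
    have "av (z k - x j) \<le> r * D i + av (x i - x j)" for j
      using ball[of k] av_diff_triangle[of "z k" "x j" "x i"] by linarith
    then have 1: "(\<Prod>j\<in>UNIV - {i}. av (z k - x j)) \<le> (\<Prod>j\<in>UNIV - {i}. r * D i + av (x i - x j))"
      by (intro prod_mono) (auto intro: av_nonneg)
    have 2: "av (denominator (z k)) \<le> 1 + \<sigma> / (1 - r)"
      using av_denominator_sum_le[OF ball lt1, of k] unfolding denominator_def
      by (intro order_trans[OF av_triangle]) simp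
    have "z (Suc k) = step (z k)"
      by (simp add: z_def)
    then have "av (poly f (z k)) = av (lead_coeff f) *
        ((\<Prod>j\<in>UNIV - {i}. av (z k - x j)) * av (denominator (z k))) * av (z (Suc k) - z k)"
      using weierstrass_form_factorization[OF ball r(2), of k]
      by (subst f) (simp add: av_mult av_prod av_diff_commute)
    also have "\<dots> \<le> C * av (z (Suc k) - z k)"
      unfolding C_def
    proof (rule mult_right_mono[OF mult_left_mono[OF mult_mono[OF 1 2]]])
      show "0 \<le> (\<Prod>j\<in>UNIV - {i}. r * D i + av (x i - x j))"
        using r D_pos[of i] by (intro prod_nonneg add_nonneg_nonneg av_nonneg) auto
    qed (rule av_nonneg)+
    also have "\<dots> \<le> C * ((t (Suc k) - t k) * D i)"
      using it(2)[of k] C_nonneg by (intro mult_left_mono) auto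
    finally show ?thesis by (simp add: algebra_simps)
  qed
  moreover have "(\<lambda>k. C * D i * (t (Suc k) - t k)) \<longlonglongrightarrow> 0"
    using tendsto_mult_right_zero[OF \<open>(\<lambda>k. t (Suc k) - t k) \<longlonglongrightarrow> 0\<close>] by simp
  ultimately have "(\<lambda>k. av (poly f (z k))) \<longlonglongrightarrow> 0"
    by (intro Lim_null_comparison[of "\<lambda>k. av (poly f (z k))"])
      (auto simp: av_nonneg intro!: always_eventually)
  then obtain \<zeta> where \<zeta>: "poly f \<zeta> = 0" "av (\<zeta> - x i) \<le> r * D i"
    using root_in_ball_of_approximate_roots[of av f z "x i" "r * D i",
        OF absolute_value_axioms \<open>f \<noteq> 0\<close> ball] by blast
  have "(\<Prod>j\<in>UNIV - {i}. \<zeta> - x j) \<noteq> 0"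
    using away_from_other_points(2)[OF \<zeta>(2) lt1] by auto
  then have "step \<zeta> = \<zeta>"
    using \<zeta>(1) f[of \<zeta>] weierstrass_form_factorization[OF \<zeta>(2) r(2)]
      denominator_nonzero[OF \<zeta>(2) r(2)] \<open>f \<noteq> 0\<close> by simp
  then have "av (\<zeta> - x i) \<le> av (W i) * ((1 - r) / (1 - r - \<sigma>))"
    using av_step_diff_center_le[OF \<zeta>(2) r(2)] by (simp only:)
  with \<zeta>(1) show ?thesis by blast
qed

end

section \<open>From the Weierstrass correction to the roots\<close>

text \<open>
  The value of \<open>s\<close> makes \<open>r\<close> a fixed point of the majorant with \<open>\<sigma> = a s\<close>, since
  \<open>1 - r - a s = (1 - r)\<^sup>2 / (1 + (a - 1) r)\<close>. The factor in the resulting bound for each root is then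
  \<open>r / s\<close>.
\<close>

lemma roots_near_approximation:
  fixes f :: "'a::alg_closed_field poly" and x :: "'a ^ 'n"
  assumes "absolute_value av" and "2 \<le> CARD('n)" and "CARD('n) = degree f"
    and inj: "inj (\<lambda>i. x $ i)"
    and p: "1 \<le> p" "conjugate_exponent p q"
    and a_def: "a = (real (degree f) - 1) powr enn2real (1 / q)"
    and r: "0 < r" "r < 1"
    and s_def: "s = r * (1 - r) / (1 + (a - 1) * r)"
    and N_def: "N = p_norm p (av_quotient av (weierstrass_correction f x) (min_dist av x))"
    and N: "N \<le> s"
  shows "\<exists>\<xi>. (\<forall>i. poly f (\<xi> $ i) = 0) \<and> 0 < s \<and>
    p_norm p (av_quotient av (x - \<xi>) (min_dist av x)) \<le> r / s * N"
proof -
  interpret absolute_value av by fact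
  define W D where "W i = weierstrass_correction f x $ i" and "D i = min_dist av x $ i" for i
  define w where "w = av_quotient av (weierstrass_correction f x) (min_dist av x)"
  have "f \<noteq> 0" using assms(2,3) by auto
  have D_pos: "0 < D i" for i
    using min_dist_attained[OF assms(2), of i av x] inj by (metis D_def av_pos injD right_minus_eq)
  have w: "\<bar>w $ i\<bar> = av (W i) / D i" for i
    using D_pos[of i] av_nonneg by (simp add: w_def av_quotient_def W_def D_def)
  have a: "1 \<le> a"
    unfolding a_def using assms(2,3) by (intro ge_one_powr_ge_zero) auto
  have den: "0 < 1 + (a - 1) * r"
    using a r by (intro add_pos_nonneg) auto
  have s: "0 < s"
    using r den by (simp add: s_def)
  have gap: "1 - r - a * s = (1 - r)\<^sup>2 / (1 + (a - 1) * r)"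
    using den unfolding s_def by (simp add: field_simps power2_eq_square)
  then have gap_pos: "0 < 1 - r - a * s"
    using r den by simp
  have "s * (1 - r) = r * (1 - r - a * s)"
    unfolding gap by (simp add: s_def power2_eq_square)
  then have fixed: "s * (1 - r) / (1 - r - a * s) = r"
    using gap_pos by simp
  then have factor: "(1 - r) / (1 - r - a * s) = r / s"
    using s by (simp add: field_simps)
  have "\<exists>\<zeta>. poly f \<zeta> = 0 \<and> av (\<zeta> - x $ i) \<le> av (W i) * (r / s)" for i
  proof -
    have "\<bar>w $ i\<bar> \<le> N"
      using sum_abs_le_p_norm[OF p, where A = "{i}" and u = w] by (simp add: N_def w_def)
    with N have "av (W i) / D i \<le> s"
      by (simp add: w)
    then have W_i: "av (W i) \<le> s * D i"
      using D_pos[of i] by (simp add: field_simps)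
    have "card (UNIV - {i}) = degree f - 1"
      using assms(3) by (simp add: card_Diff_singleton)
    then have "(\<Sum>j\<in>UNIV - {i}. \<bar>w $ j\<bar>) \<le> a * N"
      using sum_abs_le_p_norm[OF p, where A = "UNIV - {i}" and u = w] assms(2,3)
      by (simp add: N_def w_def a_def of_nat_diff)
    also have "\<dots> \<le> a * s"
      using N a by (intro mult_left_mono) auto
    finally have others: "(\<Sum>j\<in>UNIV - {i}. av (W j) / D j) \<le> a * s"
      by (simp add: w)
    interpret weierstrass_map av "\<lambda>j. x $ j" W D i s "a * s"
    proof unfold_locales
      show "D j \<le> av (x $ j - x $ k)" if "j \<noteq> k" for j k
        using that min_dist_le[of k j av x] by (simp add: D_def)
    qed (use D_pos s W_i others in auto)
    have "\<exists>\<zeta>. poly f \<zeta> = 0 \<and> av (\<zeta> - x $ i) \<le> av (W i) * ((1 - r) / (1 - r - a * s))"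
    proof (rule root_near_point[OF _ _ _ \<open>f \<noteq> 0\<close>])
      show "majorant r = r"
        using fixed by (simp add: majorant_def)
      show "poly f z = lead_coeff f *
          ((\<Prod>j\<in>UNIV. z - x $ j) + (\<Sum>k\<in>UNIV. W k * (\<Prod>j\<in>UNIV - {k}. z - x $ j)))" for z
        unfolding W_def by (rule weierstrass_correction_expansion[OF assms(3) inj])
    qed (use r gap_pos in auto)
    then show ?thesis
      by (simp only: factor)
  qed
  then obtain \<xi>' where \<xi>': "\<And>i. poly f (\<xi>' i) = 0"
      "\<And>i. av (\<xi>' i - x $ i) \<le> av (W i) * (r / s)"
    by metis
  define \<xi> where "\<xi> = (\<chi> i. \<xi>' i)"
  have "p_norm p (av_quotient av (x - \<xi>) (min_dist av x)) \<le> r / s * p_norm p w"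
  proof (rule p_norm_le_scaled[OF p(1)])
    fix i
    have "\<bar>av_quotient av (x - \<xi>) (min_dist av x) $ i\<bar> = av (\<xi>' i - x $ i) / D i"
      using D_pos[of i] av_nonneg av_diff_commute[of "x $ i"]
      by (simp add: av_quotient_def \<xi>_def D_def)
    also have "\<dots> \<le> av (W i) * (r / s) / D i"
      using \<xi>'(2)[of i] D_pos[of i] by (intro divide_right_mono) auto
    finally show "\<bar>av_quotient av (x - \<xi>) (min_dist av x) $ i\<bar> \<le> r / s * \<bar>w $ i\<bar>"
      by (simp add: w mult.commute)
  qed (use r s in simp)
  then show ?thesis
    using \<xi>'(1) s by (intro exI[of _ \<xi>]) (simp add: \<xi>_def N_def w_def)
qed

text \<open>
  If \<open>u\<^sub>i\<close> is the distance from \<open>x\<^sub>i\<close> to \<open>\<xi>\<^sub>i\<close> in units of \<open>d\<^sub>i(x)\<close>, then the distance between \<open>x\<^sub>i\<close> and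
  \<open>x\<^sub>j\<close> shrinks at most by \<open>u\<^sub>i d\<^sub>i + u\<^sub>j d\<^sub>j \<le> (u\<^sub>i + u\<^sub>j) |x\<^sub>i - x\<^sub>j|\<close>, and \<open>u\<^sub>i + u\<^sub>j \<le> b \<parallel>u\<parallel>\<close> by Hoelder's
  inequality.
\<close>

lemma min_dist_perturbation:
  fixes x \<xi> :: "'a::alg_closed_field ^ 'n"
  assumes "absolute_value av" and "2 \<le> CARD('n)"
    and inj: "inj (\<lambda>i. x $ i)"
    and p: "1 \<le> p" "conjugate_exponent p q"
    and b_def: "b = 2 powr enn2real (1 / q)"
    and N_def: "N = p_norm p (av_quotient av (x - \<xi>) (min_dist av x))"
    and N: "b * N < 1"
  shows "inj (\<lambda>i. \<xi> $ i)"
    and "p_norm p (av_quotient av (x - \<xi>) (min_dist av \<xi>)) \<le> N / (1 - b * N)"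
proof -
  interpret absolute_value av by fact
  define D where "D i = min_dist av x $ i" for i
  define u where "u = av_quotient av (x - \<xi>) (min_dist av x)"
  have D_pos: "0 < D i" for i
    using min_dist_attained[OF assms(2), of i av x] inj by (metis D_def av_pos injD right_minus_eq)
  have u: "\<bar>u $ i\<bar> * D i = av (x $ i - \<xi> $ i)" for i
    using D_pos[of i] av_nonneg by (simp add: u_def av_quotient_def D_def)
  have sep: "(1 - b * N) * av (x $ i - x $ j) \<le> av (\<xi> $ i - \<xi> $ j)" if "i \<noteq> j" for i j
  proof -
    let ?d = "av (x $ i - x $ j)"
    have D_le: "D i \<le> ?d" "D j \<le> ?d"
      using min_dist_le[of j i av x] min_dist_le[of i j av x] that av_diff_commute[of "x $ i"]
      by (auto simp: D_def)
    have "\<bar>u $ i\<bar> + \<bar>u $ j\<bar> \<le> b * N"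
      using sum_abs_le_p_norm[OF p, where A = "{i, j}" and u = u] that
      by (simp add: b_def N_def u_def)
    then have "(\<bar>u $ i\<bar> + \<bar>u $ j\<bar>) * ?d \<le> b * N * ?d"
      by (intro mult_right_mono av_nonneg)
    moreover have "\<bar>u $ i\<bar> * D i \<le> \<bar>u $ i\<bar> * ?d" "\<bar>u $ j\<bar> * D j \<le> \<bar>u $ j\<bar> * ?d"
      using D_le by (auto intro: mult_left_mono)
    ultimately have "av (x $ i - \<xi> $ i) + av (x $ j - \<xi> $ j) \<le> b * N * ?d"
      by (simp add: u distrib_right)
    moreover have "?d \<le> av (x $ i - \<xi> $ i) + av (\<xi> $ i - \<xi> $ j) + av (\<xi> $ j - x $ j)"
      using av_diff_triangle[of "x $ i" "x $ j" "\<xi> $ i"]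
        av_diff_triangle[of "\<xi> $ i" "x $ j" "\<xi> $ j"] by linarith
    ultimately show ?thesis
      using av_diff_commute[of "x $ j"] by (simp add: left_diff_distrib)
  qed
  show "inj (\<lambda>i. \<xi> $ i)"
  proof (rule injI, rule ccontr)
    fix i j assume eq: "\<xi> $ i = \<xi> $ j" and "i \<noteq> j"
    then have "0 < (1 - b * N) * av (x $ i - x $ j)"
      using N inj by (intro mult_pos_pos av_pos) (auto dest: injD)
    with sep[OF \<open>i \<noteq> j\<close>] eq show False by simp
  qed
  have D_le: "(1 - b * N) * D i \<le> min_dist av \<xi> $ i" for i
  proof -
    obtain j where j: "j \<noteq> i" "min_dist av \<xi> $ i = av (\<xi> $ i - \<xi> $ j)"
      using min_dist_attained[OF assms(2)] by blast
    have "(1 - b * N) * D i \<le> (1 - b * N) * av (x $ i - x $ j)"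
      using N min_dist_le[of j i av x] j(1) by (intro mult_left_mono) (auto simp: D_def)
    then show ?thesis
      using sep[of i j] j by simp
  qed
  have "p_norm p (av_quotient av (x - \<xi>) (min_dist av \<xi>)) \<le> 1 / (1 - b * N) * p_norm p u"
  proof (rule p_norm_le_scaled[OF p(1)])
    fix i
    have pos: "0 < (1 - b * N) * D i"
      using N D_pos by simp
    have "\<bar>av_quotient av (x - \<xi>) (min_dist av \<xi>) $ i\<bar> = av (x $ i - \<xi> $ i) / min_dist av \<xi> $ i"
      using pos D_le[of i] av_nonneg by (simp add: av_quotient_def)
    also have "\<dots> \<le> av (x $ i - \<xi> $ i) / ((1 - b * N) * D i)"
      by (rule divide_left_mono[OF D_le av_nonneg mult_pos_pos[OF less_le_trans[OF pos D_le] pos]])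
    also have "\<dots> = 1 / (1 - b * N) * \<bar>u $ i\<bar>"
      using D_pos[of i] by (simp flip: u)
    finally show "\<bar>av_quotient av (x - \<xi>) (min_dist av \<xi>) $ i\<bar> \<le> 1 / (1 - b * N) * \<bar>u $ i\<bar>" .
  qed (use N in simp)
  then show "p_norm p (av_quotient av (x - \<xi>) (min_dist av \<xi>)) \<le> N / (1 - b * N)"
    by (simp add: N_def u_def)
qed

theorem theorem6p1:
  fixes av :: "'a::alg_closed_field \<Rightarrow> real"
    and f :: "'a poly"
    and x :: "'a ^ 'n"
    and p q :: ennreal
    and a b R :: real
  assumes "absolute_value av"
    and "degree f \<ge> 2"
    and "CARD('n) = degree f"
    and "inj (\<lambda>i. x $ i)"
    and "1 \<le> p"
    and "conjugate_exponent p q"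
    and "a = (real (degree f) - 1) powr enn2real (1 / q)"
    and "b = 2 powr enn2real (1 / q)"
    and "0 < R"
    and "1 - b + sqrt a \<noteq> 0 \<longrightarrow> R \<le> 1 / (1 - b + sqrt a)"
    and "p_norm p (av_quotient av (weierstrass_correction f x) (min_dist av x))
           \<le> R * (1 + (b - 1) * R) / ((1 + b * R) * (1 + (a + b - 1) * R))"
  shows "only_simple_zeros f \<and>
    (\<exists>\<xi> :: 'a ^ 'n. root_vector f \<xi> \<and>
       p_norm p (av_quotient av (x - \<xi>) (min_dist av \<xi>)) \<le> R \<and>
       (p_norm p (av_quotient av (weierstrass_correction f x) (min_dist av x))
           < R * (1 + (b - 1) * R) / ((1 + b * R) * (1 + (a + b - 1) * R)) \<longrightarrow>
        p_norm p (av_quotient av (x - \<xi>) (min_dist av \<xi>)) < R))"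
proof -
  define bound where "bound = R * (1 + (b - 1) * R) / ((1 + b * R) * (1 + (a + b - 1) * R))"
  define N where "N = p_norm p (av_quotient av (weierstrass_correction f x) (min_dist av x))"
  \<comment> \<open>The substitution solves \<open>R = r / (1 - b r)\<close>, the loss in passing from \<open>d(x)\<close> to \<open>d(\<xi>)\<close>.\<close>
  define r where "r = R / (1 + b * R)"
  have n: "2 \<le> CARD('n)" and "f \<noteq> 0"
    using assms(2,3) by auto
  have b: "1 \<le> b"
    unfolding assms(8) by (intro ge_one_powr_ge_zero) auto
  have a: "1 \<le> a"
    unfolding assms(7) using assms(2) by (intro ge_one_powr_ge_zero) auto
  have "R \<le> b * R"
    using b \<open>0 < R\<close> by simp
  then have pos: "0 < 1 + b * R" "R < 1 + b * R"
    using \<open>0 < R\<close> by linarith+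
  have r: "0 < r" "r < 1"
    using \<open>0 < R\<close> pos by (simp_all add: r_def)
  have br: "1 - b * r = 1 / (1 + b * R)"
    using pos by (simp add: r_def field_simps)
  have R: "R = r / (1 - b * r)"
    unfolding br using pos by (simp add: r_def)
  have den: "1 + (a - 1) * r = (1 + (a + b - 1) * R) / (1 + b * R)"
    and num: "1 - r = (1 + (b - 1) * R) / (1 + b * R)"
    using pos by (simp_all add: r_def field_simps)
  have s: "bound = r * (1 - r) / (1 + (a - 1) * r)"
    unfolding den num bound_def using pos by (simp add: r_def)
  have "N \<le> bound"
    using assms(11) by (simp add: N_def bound_def)
  from roots_near_approximation[OF assms(1) n assms(3-7) r s N_def this]
  obtain \<xi> :: "'a ^ 'n" where \<xi>: "\<And>i. poly f (\<xi> $ i) = 0" and "0 < bound"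
    and M: "p_norm p (av_quotient av (x - \<xi>) (min_dist av x)) \<le> r / bound * N"
    by blast
  define M where "M = p_norm p (av_quotient av (x - \<xi>) (min_dist av x))"
  have "r / bound * N \<le> r / bound * bound"
    using \<open>N \<le> bound\<close> r \<open>0 < bound\<close> by (intro mult_left_mono) auto
  then have "M \<le> r"
    using M \<open>0 < bound\<close> by (simp add: M_def)
  then have "b * M \<le> b * r"
    using b by (intro mult_left_mono) auto
  moreover have "b * r < 1"
    using br pos by (smt (verit) divide_pos_pos)
  ultimately have bM: "b * M < 1" by simp
  note perturb = min_dist_perturbation[OF assms(1) n assms(4-6,8) M_def bM]
  note f = factorization_of_distinct_roots[OF assms(3) perturb(1) \<xi>]
  have final: "p_norm p (av_quotient av (x - \<xi>) (min_dist av \<xi>)) \<le> M / (1 - b * r)"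
  proof (rule order_trans[OF perturb(2)])
    show "M / (1 - b * M) \<le> M / (1 - b * r)"
      using \<open>b * M \<le> b * r\<close> \<open>b * r < 1\<close> p_norm_nonneg[of p]
      by (intro divide_left_mono mult_pos_pos) (auto simp: M_def)
  qed
  have "only_simple_zeros f"
    using only_simple_zeros_of_distinct_factors[OF \<open>f \<noteq> 0\<close> f perturb(1)] .
  moreover have "root_vector f \<xi>"
    unfolding root_vector_def by (subst f) (simp add: poly_prod)
  moreover have "p_norm p (av_quotient av (x - \<xi>) (min_dist av \<xi>)) \<le> R"
    using \<open>M \<le> r\<close> \<open>b * r < 1\<close> by (subst R) (intro order_trans[OF final] divide_right_mono, auto)
  moreover have "p_norm p (av_quotient av (x - \<xi>) (min_dist av \<xi>)) < R" if "N < bound"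
  proof -
    have "r / bound * N < r / bound * bound"
      using that r \<open>0 < bound\<close> by (intro mult_strict_left_mono) auto
    then have "M < r"
      using M \<open>0 < bound\<close> by (simp add: M_def)
    then have "M / (1 - b * r) < R"
      using \<open>b * r < 1\<close> by (subst R) (intro divide_strict_right_mono, auto)
    then show ?thesis
      using final by linarith
  qed
  ultimately show ?thesis
    unfolding N_def bound_def by blast
qed

end
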